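(* Let $(M,J,g)$ be a Norden manifold, let $a,b$ be real numbers with $a\neq 0$, and let $J_{a,b}:=aJ+bI$. Then: 1. $J_{a,b}$ is integrable if and only if $J$ is integrable. 2. $J_{a,b}$ is locally metallic if and only if $J$ is Kähler. 3. $J_{a,b}$ is nearly locally metallic if and only if $J$ is nearly Kähler.
   Context: A Norden manifold $(M,J,g)$ is an almost complex manifold $(M,J)$ (so $J^2=-I$; $J$ is not assumed integrable) with a neutral pseudo-Riemannian metric $g$ such that $g(JX,Y)=g(X,JY)$ for all $X,Y\in C^\infty(TM)$. Let $\nabla$ be the Levi-Civita connection of $g$. For a $(1,1)$-tensor field $F$ (either $J$ or $J_{a,b}$): $F$ is integrable if its Nijenhuis tensor $N_F(X,Y):=[FX,FY]-F[FX,Y]-F[X,FY]+F^2[X,Y]$ vanishes for all vector fields $X,Y$. $J_{a,b}$ is $g$-symmetric and satisfies $J_{a,b}^2=2bJ_{a,b}-(a^2+b^2)I$, so $(J_{a,b},g)$ is a metallic pseudo-Riemannian structure; it is called locally metallic if $\nabla J_{a,b}=0$, and nearly locally metallic if $(\nabla_XJ_{a,b})Y+(\nabla_YJ_{a,b})X=0$ for all $X,Y$. The Norden structure $J$ is called Kähler if $\nabla J=0$, and nearly Kähler if $(\nabla_XJ)Y+(\nabla_YJ)X=0$ for all $X,Y$. *)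

theory Defs
  imports "HOL-Analysis.Analysis" "HOL-Library.Function_Algebras"
begin

section \<open>Smooth manifolds\<close>

primrec Ck_on :: "nat \<Rightarrow> 'e::euclidean_space set \<Rightarrow> ('e \<Rightarrow> 'f::euclidean_space) \<Rightarrow> bool" where
  "Ck_on 0 S f \<longleftrightarrow> continuous_on S f"
| "Ck_on (Suc k) S f \<longleftrightarrow>
     (\<forall>x\<in>S. f differentiable (at x)) \<and> (\<forall>v. Ck_on k S (\<lambda>x. frechet_derivative f (at x) v))"

text \<open>Only used for open \<open>S\<close>; the values of \<open>f\<close> outside \<open>S\<close> are then irrelevant.\<close>

definition smooth_on :: "'e::euclidean_space set \<Rightarrow> ('e \<Rightarrow> 'f::euclidean_space) \<Rightarrow> bool" where
  "smooth_on S f \<longleftrightarrow> (\<forall>k. Ck_on k S f)"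

record ('a, 'e) manifold =
  mtop :: "'a topology"
  atlas :: "('a set \<times> ('a \<Rightarrow> 'e)) set"

abbreviation points :: "('a, 'e) manifold \<Rightarrow> 'a set" where
  "points M \<equiv> topspace (mtop M)"

definition is_chart :: "('a, 'e::euclidean_space) manifold \<Rightarrow> 'a set \<Rightarrow> ('a \<Rightarrow> 'e) \<Rightarrow> bool" where
  "is_chart M U \<phi> \<longleftrightarrow>
     openin (mtop M) U \<and> open (\<phi> ` U) \<and>
     homeomorphic_map (subtopology (mtop M) U) (top_of_set (\<phi> ` U)) \<phi>"

text \<open>The atlas need not be maximal: smooth functions, hence everything below, depend only on the
  maximal atlas it generates.\<close>

definition smooth_manifold :: "('a, 'e::euclidean_space) manifold \<Rightarrow> bool" where
  "smooth_manifold M \<longleftrightarrow>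
     Hausdorff_space (mtop M) \<and> second_countable (mtop M) \<and>
     (\<forall>(U, \<phi>) \<in> atlas M. is_chart M U \<phi>) \<and>
     (\<Union>(U, \<phi>) \<in> atlas M. U) = points M \<and>
     (\<forall>(U, \<phi>) \<in> atlas M. \<forall>(V, \<psi>) \<in> atlas M.
        smooth_on (\<phi> ` (U \<inter> V)) (\<psi> \<circ> inv_into U \<phi>))"

text \<open>Functions on \<open>M\<close> are represented by total functions that vanish off \<open>points M\<close>, so that
  equality of functions on \<open>M\<close> is equality in HOL. Likewise a tangent vector vanishes on
  arguments that are not smooth functions, and a vector field vanishes off \<open>points M\<close>.
  Sums, differences, negatives and zero of functions, tangent vectors and vector fields are the
  pointwise ones from \<open>Function_Algebras\<close>; so is the product of functions.\<close>

definition smooth_funs :: "('a, 'e::euclidean_space) manifold \<Rightarrow> ('a \<Rightarrow> real) set" where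
  "smooth_funs M =
     {f. (\<forall>p. p \<notin> points M \<longrightarrow> f p = 0) \<and>
         (\<forall>(U, \<phi>) \<in> atlas M. smooth_on (\<phi> ` U) (f \<circ> inv_into U \<phi>))}"


section \<open>Tangent vectors and vector fields\<close>

type_synonym 'a tvec = "('a \<Rightarrow> real) \<Rightarrow> real"
type_synonym 'a vfield = "'a \<Rightarrow> 'a tvec"
type_synonym 'a endo = "'a \<Rightarrow> 'a tvec \<Rightarrow> 'a tvec"
type_synonym 'a bilin = "'a \<Rightarrow> 'a tvec \<Rightarrow> 'a tvec \<Rightarrow> real"
type_synonym 'a conn = "'a vfield \<Rightarrow> 'a vfield \<Rightarrow> 'a vfield"

definition scl :: "real \<Rightarrow> ('x \<Rightarrow> real) \<Rightarrow> 'x \<Rightarrow> real" (infixr "\<cdot>\<^sub>R" 75) where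
  "c \<cdot>\<^sub>R v = (\<lambda>x. c * v x)"

definition fscl :: "('a \<Rightarrow> real) \<Rightarrow> 'a vfield \<Rightarrow> 'a vfield" (infixr "\<cdot>\<^sub>F" 75) where
  "h \<cdot>\<^sub>F X = (\<lambda>p. h p \<cdot>\<^sub>R X p)"

text \<open>Tangent vectors at \<open>p\<close> are the derivations at \<open>p\<close> of the algebra of smooth functions.\<close>

definition tangent_space :: "('a, 'e::euclidean_space) manifold \<Rightarrow> 'a \<Rightarrow> 'a tvec set" where
  "tangent_space M p =
     {v. (\<forall>f. f \<notin> smooth_funs M \<longrightarrow> v f = 0) \<and>
         (\<forall>f\<in>smooth_funs M. \<forall>h\<in>smooth_funs M. v (f + h) = v f + v h) \<and>
         (\<forall>c. \<forall>f\<in>smooth_funs M. v (c \<cdot>\<^sub>R f) = c * v f) \<and>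
         (\<forall>f\<in>smooth_funs M. \<forall>h\<in>smooth_funs M. v (f * h) = f p * v h + h p * v f)}"

text \<open>\<open>ddir X f\<close> is the function \<open>X f\<close>.\<close>

definition ddir :: "'a vfield \<Rightarrow> ('a \<Rightarrow> real) \<Rightarrow> 'a \<Rightarrow> real" where
  "ddir X f = (\<lambda>p. X p f)"

definition vector_fields :: "('a, 'e::euclidean_space) manifold \<Rightarrow> 'a vfield set" where
  "vector_fields M =
     {X. (\<forall>p\<in>points M. X p \<in> tangent_space M p) \<and>
         (\<forall>p. p \<notin> points M \<longrightarrow> X p = 0) \<and>
         (\<forall>f\<in>smooth_funs M. ddir X f \<in> smooth_funs M)}"

definition lie_bracket :: "'a vfield \<Rightarrow> 'a vfield \<Rightarrow> 'a vfield" where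
  "lie_bracket X Y = (\<lambda>p f. X p (ddir Y f) - Y p (ddir X f))"


section \<open>(1,1)-tensor fields\<close>

definition app :: "'a endo \<Rightarrow> 'a vfield \<Rightarrow> 'a vfield" where
  "app F X = (\<lambda>p. F p (X p))"

text \<open>The last condition is smoothness; off \<open>points M\<close> it only says \<open>F p 0 = 0\<close>.\<close>

definition endo_field :: "('a, 'e::euclidean_space) manifold \<Rightarrow> 'a endo \<Rightarrow> bool" where
  "endo_field M F \<longleftrightarrow>
     (\<forall>p\<in>points M.
        (\<forall>v\<in>tangent_space M p. F p v \<in> tangent_space M p) \<and>
        (\<forall>v\<in>tangent_space M p. \<forall>w\<in>tangent_space M p. F p (v + w) = F p v + F p w) \<and>
        (\<forall>c. \<forall>v\<in>tangent_space M p. F p (c \<cdot>\<^sub>R v) = c \<cdot>\<^sub>R F p v)) \<and>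
     (\<forall>X\<in>vector_fields M. app F X \<in> vector_fields M)"

definition nijenhuis :: "'a endo \<Rightarrow> 'a vfield \<Rightarrow> 'a vfield \<Rightarrow> 'a vfield" where
  "nijenhuis F X Y =
     lie_bracket (app F X) (app F Y) - app F (lie_bracket (app F X) Y)
       - app F (lie_bracket X (app F Y)) + app F (app F (lie_bracket X Y))"

definition integrable_endo :: "('a, 'e::euclidean_space) manifold \<Rightarrow> 'a endo \<Rightarrow> bool" where
  "integrable_endo M F \<longleftrightarrow>
     (\<forall>X\<in>vector_fields M. \<forall>Y\<in>vector_fields M. nijenhuis F X Y = 0)"


section \<open>Pseudo-Riemannian metrics and the Levi-Civita connection\<close>

definition pseudo_riemannian_metric ::
    "('a, 'e::euclidean_space) manifold \<Rightarrow> 'a bilin \<Rightarrow> bool" where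
  "pseudo_riemannian_metric M g \<longleftrightarrow>
     (\<forall>p\<in>points M. \<forall>u\<in>tangent_space M p. \<forall>v\<in>tangent_space M p.
        g p u v = g p v u \<and>
        (\<forall>w\<in>tangent_space M p. g p (u + v) w = g p u w + g p v w) \<and>
        (\<forall>c. g p (c \<cdot>\<^sub>R u) v = c * g p u v)) \<and>
     (\<forall>p\<in>points M. \<forall>u\<in>tangent_space M p. (\<forall>v\<in>tangent_space M p. g p u v = 0) \<longrightarrow> u = 0) \<and>
     (\<forall>X\<in>vector_fields M. \<forall>Y\<in>vector_fields M. (\<lambda>p. g p (X p) (Y p)) \<in> smooth_funs M)"

text \<open>\<open>g p\<close> has an orthonormal basis with \<open>r\<close> vectors of square \<open>1\<close> followed by \<open>s\<close> vectors of
  square \<open>-1\<close>; linear independence of the \<open>e i\<close> is implied.\<close>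

definition has_signature ::
    "('a, 'e::euclidean_space) manifold \<Rightarrow> 'a bilin \<Rightarrow> 'a \<Rightarrow> nat \<Rightarrow> nat \<Rightarrow> bool" where
  "has_signature M g p r s \<longleftrightarrow>
     (\<exists>e :: nat \<Rightarrow> 'a tvec.
        (\<forall>i<r+s. e i \<in> tangent_space M p) \<and>
        (\<forall>v\<in>tangent_space M p. \<exists>c :: nat \<Rightarrow> real. v = (\<Sum>i<r+s. c i \<cdot>\<^sub>R e i)) \<and>
        (\<forall>i<r+s. \<forall>j<r+s. g p (e i) (e j) = (if i \<noteq> j then 0 else if i < r then 1 else -1)))"

definition neutral_metric :: "('a, 'e::euclidean_space) manifold \<Rightarrow> 'a bilin \<Rightarrow> bool" where
  "neutral_metric M g \<longleftrightarrow>
     pseudo_riemannian_metric M g \<and> (\<exists>n. \<forall>p\<in>points M. has_signature M g p n n)"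

definition affine_connection ::
    "('a, 'e::euclidean_space) manifold \<Rightarrow> 'a conn \<Rightarrow> bool" where
  "affine_connection M D \<longleftrightarrow>
     (\<forall>X\<in>vector_fields M. \<forall>Y\<in>vector_fields M. D X Y \<in> vector_fields M) \<and>
     (\<forall>X\<in>vector_fields M. \<forall>Y\<in>vector_fields M. \<forall>Z\<in>vector_fields M.
        D (X + Y) Z = D X Z + D Y Z \<and> D Z (X + Y) = D Z X + D Z Y) \<and>
     (\<forall>f\<in>smooth_funs M. \<forall>X\<in>vector_fields M. \<forall>Y\<in>vector_fields M.
        D (f \<cdot>\<^sub>F X) Y = f \<cdot>\<^sub>F D X Y \<and>
        D X (f \<cdot>\<^sub>F Y) = ddir X f \<cdot>\<^sub>F Y + f \<cdot>\<^sub>F D X Y)"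

definition levi_civita ::
    "('a, 'e::euclidean_space) manifold \<Rightarrow> 'a bilin \<Rightarrow> 'a conn \<Rightarrow> bool" where
  "levi_civita M g D \<longleftrightarrow>
     affine_connection M D \<and>
     (\<forall>X\<in>vector_fields M. \<forall>Y\<in>vector_fields M. D X Y - D Y X = lie_bracket X Y) \<and>
     (\<forall>X\<in>vector_fields M. \<forall>Y\<in>vector_fields M. \<forall>Z\<in>vector_fields M.
        ddir X (\<lambda>p. g p (Y p) (Z p)) =
          (\<lambda>p. g p (D X Y p) (Z p)) + (\<lambda>p. g p (Y p) (D X Z p)))"

definition cov_deriv :: "'a conn \<Rightarrow> 'a vfield \<Rightarrow> 'a endo \<Rightarrow> 'a vfield \<Rightarrow> 'a vfield" where
  "cov_deriv D X F Y = D X (app F Y) - app F (D X Y)"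

definition parallel_endo ::
    "('a, 'e::euclidean_space) manifold \<Rightarrow> 'a conn \<Rightarrow> 'a endo \<Rightarrow> bool" where
  "parallel_endo M D F \<longleftrightarrow>
     (\<forall>X\<in>vector_fields M. \<forall>Y\<in>vector_fields M. cov_deriv D X F Y = 0)"

definition nearly_parallel_endo ::
    "('a, 'e::euclidean_space) manifold \<Rightarrow> 'a conn \<Rightarrow> 'a endo \<Rightarrow> bool" where
  "nearly_parallel_endo M D F \<longleftrightarrow>
     (\<forall>X\<in>vector_fields M. \<forall>Y\<in>vector_fields M. cov_deriv D X F Y + cov_deriv D Y F X = 0)"


section \<open>Norden and metallic structures\<close>

definition g_symmetric ::
    "('a, 'e::euclidean_space) manifold \<Rightarrow> 'a bilin \<Rightarrow> 'a endo \<Rightarrow> bool" where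
  "g_symmetric M g F \<longleftrightarrow>
     (\<forall>X\<in>vector_fields M. \<forall>Y\<in>vector_fields M. \<forall>p\<in>points M.
        g p (app F X p) (Y p) = g p (X p) (app F Y p))"

definition almost_complex :: "('a, 'e::euclidean_space) manifold \<Rightarrow> 'a endo \<Rightarrow> bool" where
  "almost_complex M J \<longleftrightarrow>
     endo_field M J \<and> (\<forall>p\<in>points M. \<forall>v\<in>tangent_space M p. J p (J p v) = - v)"

definition norden_manifold ::
    "('a, 'e::euclidean_space) manifold \<Rightarrow> 'a endo \<Rightarrow> 'a bilin \<Rightarrow> bool" where
  "norden_manifold M J g \<longleftrightarrow>
     smooth_manifold M \<and> almost_complex M J \<and> neutral_metric M g \<and> g_symmetric M g J"

definition kaehler_norden ::
    "('a, 'e::euclidean_space) manifold \<Rightarrow> 'a endo \<Rightarrow> 'a bilin \<Rightarrow> 'a conn \<Rightarrow> bool" where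
  "kaehler_norden M J g D \<longleftrightarrow> norden_manifold M J g \<and> parallel_endo M D J"

definition nearly_kaehler_norden ::
    "('a, 'e::euclidean_space) manifold \<Rightarrow> 'a endo \<Rightarrow> 'a bilin \<Rightarrow> 'a conn \<Rightarrow> bool" where
  "nearly_kaehler_norden M J g D \<longleftrightarrow> norden_manifold M J g \<and> nearly_parallel_endo M D J"

definition metallic_pseudo_riemannian ::
    "('a, 'e::euclidean_space) manifold \<Rightarrow> 'a endo \<Rightarrow> 'a bilin \<Rightarrow> bool" where
  "metallic_pseudo_riemannian M F g \<longleftrightarrow>
     smooth_manifold M \<and> endo_field M F \<and> pseudo_riemannian_metric M g \<and> g_symmetric M g F \<and>
     (\<exists>r s :: real. \<forall>p\<in>points M. \<forall>v\<in>tangent_space M p.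
        F p (F p v) = r \<cdot>\<^sub>R F p v + s \<cdot>\<^sub>R v)"

definition locally_metallic ::
    "('a, 'e::euclidean_space) manifold \<Rightarrow> 'a endo \<Rightarrow> 'a bilin \<Rightarrow> 'a conn \<Rightarrow> bool" where
  "locally_metallic M F g D \<longleftrightarrow> metallic_pseudo_riemannian M F g \<and> parallel_endo M D F"

definition nearly_locally_metallic ::
    "('a, 'e::euclidean_space) manifold \<Rightarrow> 'a endo \<Rightarrow> 'a bilin \<Rightarrow> 'a conn \<Rightarrow> bool" where
  "nearly_locally_metallic M F g D \<longleftrightarrow> metallic_pseudo_riemannian M F g \<and> nearly_parallel_endo M D F"

text \<open>The tensor field \<open>J\<^sub>a\<^sub>,\<^sub>b = a J + b I\<close>.\<close>

definition J_ab :: "'a endo \<Rightarrow> real \<Rightarrow> real \<Rightarrow> 'a endo" where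
  "J_ab J a b = (\<lambda>p v. a \<cdot>\<^sub>R J p v + b \<cdot>\<^sub>R v)"

end

theory Submission
  imports Defs
begin

text \<open>Everything rests on real bilinearity: the identity terms in \<open>J\<^sub>a\<^sub>,\<^sub>b = a J + b I\<close> cancel, so that
  \<open>N\<^bsub>aJ+bI\<^esub> = a\<^sup>2 N\<^sub>J\<close> and \<open>\<nabla>(a J + b I) = a \<nabla>J\<close>, and \<open>a\<close> is invertible. Since \<open>J\<close> is only linear
  on tangent vectors, the first identity needs the bracket of vector fields to be a field of
  derivations, and this needs products of smooth functions to be smooth. Real homogeneity of
  \<open>\<nabla>\<close> is the Leibniz rule for a constant function.\<close>

section \<open>Smooth functions\<close>

text \<open>At a point of an open set the derivative depends only on nearby values, so agreement on
  \<open>S\<close> passes to all derivatives. This lets the sum and product rules, known only on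
  \<open>S\<close>, be used under \<open>Ck_on\<close>, although \<open>frechet_derivative\<close>
  is arbitrary where a function is not differentiable.\<close>

lemma Ck_on_cong:
  assumes "open S" "\<And>x. x \<in> S \<Longrightarrow> f x = h x" "Ck_on k S f"
  shows "Ck_on k S h"
  using assms(2,3)
proof (induction k arbitrary: f h)
  case 0
  then show ?case by (simp cong: continuous_on_cong)
next
  case (Suc k)
  have der: "(h has_derivative frechet_derivative f (at x)) (at x)" if "x \<in> S" for x
  proof (rule has_derivative_transform_within_open)
    show "(f has_derivative frechet_derivative f (at x)) (at x)"
      using Suc.prems(2) that by (simp add: frechet_derivative_works)
  qed (use assms(1) that Suc.prems(1) in auto)
  have "Ck_on k S (\<lambda>x. frechet_derivative h (at x) v)" for v
  proof (rule Suc.IH)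
    show "Ck_on k S (\<lambda>x. frechet_derivative f (at x) v)"
      using Suc.prems(2) by simp
    show "frechet_derivative f (at x) v = frechet_derivative h (at x) v" if "x \<in> S" for x
      using frechet_derivative_at[OF der[OF that]] by simp
  qed
  then show ?case using der by (auto simp: differentiable_def)
qed

text \<open>The base case is that differentiability implies continuity. The product rule needs this,
  since each of its terms contains an undifferentiated factor.\<close>

lemma Ck_on_SucD: "Ck_on (Suc k) S f \<Longrightarrow> Ck_on k S f"
proof (induction k arbitrary: f)
  case 0
  then show ?case
    by (auto intro!: continuous_at_imp_continuous_on differentiable_imp_continuous_within)
next
  case (Suc k)
  then show ?case by (metis Ck_on.simps(2))
qed

lemma Ck_on_const: "Ck_on k S (\<lambda>_. c)"
  by (induction k arbitrary: c) auto

lemma Ck_on_add: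
  assumes "open S" "Ck_on k S f" "Ck_on k S h"
  shows "Ck_on k S (\<lambda>x. f x + h x)"
  using assms(2,3)
proof (induction k arbitrary: f h)
  case 0
  then show ?case by (simp add: continuous_on_add)
next
  case (Suc k)
  have "Ck_on k S (\<lambda>x. frechet_derivative (\<lambda>x. f x + h x) (at x) v)" for v
  proof (rule Ck_on_cong[OF assms(1)])
    show "Ck_on k S (\<lambda>x. frechet_derivative f (at x) v + frechet_derivative h (at x) v)"
      using Suc by simp
    show "frechet_derivative f (at x) v + frechet_derivative h (at x) v
        = frechet_derivative (\<lambda>x. f x + h x) (at x) v" if "x \<in> S" for x
    proof -
      have "(f has_derivative frechet_derivative f (at x)) (at x)"
        "(h has_derivative frechet_derivative h (at x)) (at x)"
        using Suc.prems that by (simp_all add: frechet_derivative_works)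
      from frechet_derivative_at[OF has_derivative_add[OF this]] show ?thesis by metis
    qed
  qed
  then show ?case using Suc.prems by simp
qed

lemma Ck_on_mult:
  fixes f h :: "'e::euclidean_space \<Rightarrow> real"
  assumes "open S" "Ck_on k S f" "Ck_on k S h"
  shows "Ck_on k S (\<lambda>x. f x * h x)"
  using assms(2,3)
proof (induction k arbitrary: f h)
  case 0
  then show ?case by (simp add: continuous_on_mult)
next
  case (Suc k)
  have "Ck_on k S (\<lambda>x. frechet_derivative (\<lambda>x. f x * h x) (at x) v)" for v
  proof (rule Ck_on_cong[OF assms(1)])
    \<comment> \<open>The undifferentiated factors are lowered to order \<open>k\<close>; the
      induction hypothesis, general in both functions, then covers each product.\<close>
    show "Ck_on k S (\<lambda>x. f x * frechet_derivative h (at x) v + frechet_derivative f (at x) v * h x)"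
      using Suc.prems Suc.prems[THEN Ck_on_SucD]
      by (intro Ck_on_add[OF assms(1)] Suc.IH) simp_all
    show "f x * frechet_derivative h (at x) v + frechet_derivative f (at x) v * h x
        = frechet_derivative (\<lambda>x. f x * h x) (at x) v" if "x \<in> S" for x
    proof -
      have "(f has_derivative frechet_derivative f (at x)) (at x)"
        "(h has_derivative frechet_derivative h (at x)) (at x)"
        using Suc.prems that by (simp_all add: frechet_derivative_works)
      from frechet_derivative_at[OF has_derivative_mult[OF this]] show ?thesis by metis
    qed
  qed
  then show ?case using Suc.prems by simp
qed

section \<open>The algebra of smooth functions on a manifold\<close>

lemma open_chart_image:
  "smooth_manifold M \<Longrightarrow> (U, \<phi>) \<in> atlas M \<Longrightarrow> open (\<phi> ` U)"
  by (auto simp: smooth_manifold_def is_chart_def)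

lemma smooth_funs_iff:
  "f \<in> smooth_funs M \<longleftrightarrow> (\<forall>p. p \<notin> points M \<longrightarrow> f p = 0) \<and>
     (\<forall>U \<phi> k. (U, \<phi>) \<in> atlas M \<longrightarrow> Ck_on k (\<phi> ` U) (\<lambda>x. f (inv_into U \<phi> x)))"
  unfolding smooth_funs_def smooth_on_def o_def by blast

lemma smooth_funs_add:
  assumes "smooth_manifold M" "f \<in> smooth_funs M" "h \<in> smooth_funs M"
  shows "f + h \<in> smooth_funs M"
  using assms by (simp add: smooth_funs_iff Ck_on_add open_chart_image)

lemma smooth_funs_mult:
  assumes "smooth_manifold M" "f \<in> smooth_funs M" "h \<in> smooth_funs M"
  shows "f * h \<in> smooth_funs M"
  using assms by (simp add: smooth_funs_iff Ck_on_mult open_chart_image)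

lemma smooth_funs_scl:
  assumes "smooth_manifold M" "f \<in> smooth_funs M"
  shows "c \<cdot>\<^sub>R f \<in> smooth_funs M"
  using assms by (simp add: smooth_funs_iff scl_def Ck_on_mult Ck_on_const open_chart_image)

lemma smooth_funs_zero: "0 \<in> smooth_funs M"
  by (auto simp: smooth_funs_def smooth_on_def o_def Ck_on_const)

text \<open>Smooth functions must vanish off the points, so the constant is cut off there. It turns
  a real scalar into a function multiplier, as the Leibniz rule of a connection requires.\<close>

definition const_fun :: "('a, 'e::euclidean_space) manifold \<Rightarrow> real \<Rightarrow> 'a \<Rightarrow> real" where
  "const_fun M c = (\<lambda>p. if p \<in> points M then c else 0)"

lemma smooth_funs_const:
  assumes "smooth_manifold M"
  shows "const_fun M c \<in> smooth_funs M"
proof -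
  have "Ck_on k (\<phi> ` U) (const_fun M c \<circ> inv_into U \<phi>)" if "(U, \<phi>) \<in> atlas M" for U \<phi> k
  proof (rule Ck_on_cong[OF open_chart_image[OF assms that]])
    show "Ck_on k (\<phi> ` U) (\<lambda>_. c)" by (rule Ck_on_const)
    \<comment> \<open>Chart domains lie inside the manifold, so no chart sees the cut-off.\<close>
    have "U \<subseteq> points M"
      using assms that by (auto simp: smooth_manifold_def)
    then show "c = (const_fun M c \<circ> inv_into U \<phi>) x" if "x \<in> \<phi> ` U" for x
      using inv_into_into[OF that] by (auto simp: const_fun_def)
  qed
  then show ?thesis by (auto simp: smooth_funs_def smooth_on_def const_fun_def)
qed

section \<open>Vector fields\<close>

lemma tangent_space_lin:
  assumes "v \<in> tangent_space M p" "w \<in> tangent_space M p"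
  shows "c \<cdot>\<^sub>R v + d \<cdot>\<^sub>R w \<in> tangent_space M p"
  using assms by (auto simp: tangent_space_def scl_def algebra_simps)

lemma tangent_space_scl: "v \<in> tangent_space M p \<Longrightarrow> c \<cdot>\<^sub>R v \<in> tangent_space M p"
  by (auto simp: tangent_space_def scl_def algebra_simps)

text \<open>Sums and real multiples are merged into one operation, so that each operator needs a
  single linearity rule and \<open>app (J_ab J a b) X\<close> is itself such a combination.\<close>

definition vlin :: "real \<Rightarrow> 'a vfield \<Rightarrow> real \<Rightarrow> 'a vfield \<Rightarrow> 'a vfield" where
  "vlin c X d Y = (\<lambda>p. c \<cdot>\<^sub>R X p + d \<cdot>\<^sub>R Y p)"

lemma vlin_apply: "vlin c X d Y p f = c * X p f + d * Y p f"
  by (simp add: vlin_def scl_def)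

lemma ddir_vlin: "ddir (vlin c X d Y) f = c \<cdot>\<^sub>R ddir X f + d \<cdot>\<^sub>R ddir Y f"
  by (auto simp: ddir_def vlin_def scl_def)

lemma vector_fieldsD:
  assumes "X \<in> vector_fields M"
  shows "p \<in> points M \<Longrightarrow> X p \<in> tangent_space M p"
    and "p \<notin> points M \<Longrightarrow> X p = 0"
    and "f \<in> smooth_funs M \<Longrightarrow> ddir X f \<in> smooth_funs M"
  using assms by (auto simp: vector_fields_def)

lemma vector_fields_vlin:
  assumes "smooth_manifold M" "X \<in> vector_fields M" "Y \<in> vector_fields M"
  shows "vlin c X d Y \<in> vector_fields M"
proof -
  have "ddir (vlin c X d Y) f \<in> smooth_funs M" if "f \<in> smooth_funs M" for f
    using assms that by (simp add: ddir_vlin smooth_funs_add smooth_funs_scl vector_fieldsD(3))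
  then show ?thesis
    using assms by (auto simp: vector_fields_def vlin_def tangent_space_lin)
       (auto simp: scl_def)
qed

section \<open>Vector fields as derivations\<close>

lemma vector_field_lin:
  assumes "smooth_manifold M" "X \<in> vector_fields M" "f \<in> smooth_funs M" "h \<in> smooth_funs M"
  shows "X p (c \<cdot>\<^sub>R f + d \<cdot>\<^sub>R h) = c * X p f + d * X p h"
proof (cases "p \<in> points M")
  case True
  then have "X p \<in> tangent_space M p"
    using assms by (simp add: vector_fieldsD)
  then show ?thesis
    using assms smooth_funs_scl[OF assms(1)] by (simp add: tangent_space_def)
next
  case False
  then show ?thesis using vector_fieldsD(2)[OF assms(2)] by simp
qed

lemma vector_field_mult:
  assumes "X \<in> vector_fields M" "f \<in> smooth_funs M" "h \<in> smooth_funs M"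
  shows "X p (f * h) = f p * X p h + h p * X p f"
proof (cases "p \<in> points M")
  case True
  then have "X p \<in> tangent_space M p"
    using assms by (simp add: vector_fieldsD)
  then show ?thesis
    using assms by (simp add: tangent_space_def)
next
  case False
  then show ?thesis using vector_fieldsD(2)[OF assms(1)] by simp
qed

text \<open>Both default values enter here, that of tangent vectors and that of vector fields off
  the points. Identities checked on smooth functions thereby become equalities in HOL.\<close>

lemma vector_field_nonsmooth:
  assumes "X \<in> vector_fields M" "f \<notin> smooth_funs M"
  shows "X p f = 0"
  using assms vector_fieldsD(1,2)[OF assms(1), of p]
  by (cases "p \<in> points M") (auto simp: tangent_space_def)

lemma vector_field_zero:
  assumes "smooth_manifold M" "X \<in> vector_fields M"
  shows "X p 0 = 0"
  using vector_field_lin[OF assms smooth_funs_zero smooth_funs_zero, where c = 0 and d = 0 and p = p]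
  by (simp add: scl_def zero_fun_def plus_fun_def)

lemma vector_field_add:
  assumes "smooth_manifold M" "X \<in> vector_fields M" "f \<in> smooth_funs M" "h \<in> smooth_funs M"
  shows "X p (f + h) = X p f + X p h"
  using vector_field_lin[OF assms, where c = 1 and d = 1 and p = p] by (simp add: scl_def)

lemma vector_field_scl:
  assumes "smooth_manifold M" "X \<in> vector_fields M" "f \<in> smooth_funs M"
  shows "X p (c \<cdot>\<^sub>R f) = c * X p f"
  using vector_field_lin[OF assms smooth_funs_zero, where c = c and d = 0 and p = p]
  by (simp add: scl_def zero_fun_def plus_fun_def)

text \<open>The cut-off unit is idempotent, so at each point of the manifold the product rule gives
  X1 = 2 X1, hence X1 = 0. Homogeneity extends this to every constant.\<close>

lemma ddir_const_fun:
  assumes "smooth_manifold M" "X \<in> vector_fields M"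
  shows "ddir X (const_fun M c) = 0"
proof
  fix p
  let ?one = "const_fun M 1"
  have one: "?one \<in> smooth_funs M" by (rule smooth_funs_const[OF assms(1)])
  have "?one * ?one = ?one" by (auto simp: const_fun_def)
  then have "X p ?one = 2 * (?one p * X p ?one)"
    using vector_field_mult[OF assms(2) one one, where p = p] by simp
  then have "X p ?one = 0"
    by (cases "p \<in> points M") (auto simp: const_fun_def)
  moreover have "const_fun M c = c \<cdot>\<^sub>R ?one"
    by (auto simp: const_fun_def scl_def)
  ultimately show "ddir X (const_fun M c) p = 0 p"
    using vector_field_scl[OF assms one, where p = p and c = c] by (simp add: ddir_def)
qed

section \<open>The Lie bracket\<close>

text \<open>In X(Y(fh)) - Y(X(fh)) the products of first derivatives, Xf Yh and Yf Xh, occur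
  symmetrically and cancel, which leaves the product rule for the bracket.\<close>

lemma lie_bracket_in_vector_fields:
  assumes M: "smooth_manifold M" and X: "X \<in> vector_fields M" and Y: "Y \<in> vector_fields M"
  shows "lie_bracket X Y \<in> vector_fields M"
proof -
  have dd: "ddir Z f \<in> smooth_funs M" if "Z \<in> {X, Y}" "f \<in> smooth_funs M" for Z f
    using that X Y vector_fieldsD(3) by blast
  \<comment> \<open>With \<open>vector_field_zero\<close> this makes the bracket vanish on
    non-smooth arguments, as a tangent vector must.\<close>
  have dd0: "ddir Z f = 0" if "Z \<in> {X, Y}" "f \<notin> smooth_funs M" for Z f
    using that X Y vector_field_nonsmooth by (fastforce simp: ddir_def)
  have add: "ddir Z (f + h) = ddir Z f + ddir Z h"
    if "Z \<in> {X, Y}" "f \<in> smooth_funs M" "h \<in> smooth_funs M" for Z f h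
    using that X Y vector_field_add[OF M] by (fastforce simp: ddir_def)
  have scl: "ddir Z (c \<cdot>\<^sub>R f) = c \<cdot>\<^sub>R ddir Z f"
    if "Z \<in> {X, Y}" "f \<in> smooth_funs M" for Z f c
    using that X Y vector_field_scl[OF M] by (auto simp: ddir_def scl_def[of _ "\<lambda>p. _ p"])
  have mult: "ddir Z (f * h) = f * ddir Z h + h * ddir Z f"
    if "Z \<in> {X, Y}" "f \<in> smooth_funs M" "h \<in> smooth_funs M" for Z f h
    using that X Y vector_field_mult by (fastforce simp: ddir_def)
  note sm = smooth_funs_add[OF M] smooth_funs_mult[OF M] smooth_funs_scl[OF M]
  note lin = vector_field_add[OF M X] vector_field_add[OF M Y]
    vector_field_scl[OF M X] vector_field_scl[OF M Y]
    vector_field_mult[OF X] vector_field_mult[OF Y]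
    vector_field_zero[OF M X] vector_field_zero[OF M Y]
  have "lie_bracket X Y p \<in> tangent_space M p" if "p \<in> points M" for p
    unfolding tangent_space_def lie_bracket_def
    by (auto simp: dd0 dd add scl mult lin sm)
       (auto simp: ddir_def algebra_simps)
  moreover have "lie_bracket X Y p = 0" if "p \<notin> points M" for p
    using vector_fieldsD(2)[OF X that] vector_fieldsD(2)[OF Y that]
    by (auto simp: lie_bracket_def)
  moreover have "ddir (lie_bracket X Y) f \<in> smooth_funs M" if "f \<in> smooth_funs M" for f
  proof -
    have "ddir (lie_bracket X Y) f = ddir X (ddir Y f) + (-1) \<cdot>\<^sub>R ddir Y (ddir X f)"
      by (auto simp: ddir_def lie_bracket_def scl_def)
    then show ?thesis using that by (simp add: sm dd)
  qed
  ultimately show ?thesis by (auto simp: vector_fields_def)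
qed

text \<open>On smooth arguments the first term of the bracket is linear by unfolding; in the second,
  \<open>Z\<close> acts on a combination of smooth functions and its linearity is used.\<close>

lemma lie_bracket_vlin_left:
  assumes M: "smooth_manifold M" and "X \<in> vector_fields M" "Y \<in> vector_fields M"
    and Z: "Z \<in> vector_fields M"
  shows "lie_bracket (vlin c X d Y) Z = vlin c (lie_bracket X Z) d (lie_bracket Y Z)"
proof (intro ext)
  fix p f
  show "lie_bracket (vlin c X d Y) Z p f = vlin c (lie_bracket X Z) d (lie_bracket Y Z) p f"
  proof (cases "f \<in> smooth_funs M")
    case True
    then show ?thesis
      using assms vector_field_lin[OF M Z]
      by (simp add: lie_bracket_def ddir_vlin vlin_apply vector_fieldsD(3) algebra_simps)
  next
    case False
    \<comment> \<open>On a non-smooth argument every bracket involved is zero, because it is a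
      vector field.\<close>
    then have "lie_bracket V W p f = 0" if "V \<in> vector_fields M" "W \<in> vector_fields M" for V W
      by (rule vector_field_nonsmooth[OF lie_bracket_in_vector_fields[OF M that]])
    then show ?thesis
      using assms by (simp add: vlin_apply vector_fields_vlin)
  qed
qed

lemma lie_bracket_vlin_right:
  assumes "smooth_manifold M" "X \<in> vector_fields M" "Y \<in> vector_fields M" "Z \<in> vector_fields M"
  shows "lie_bracket Z (vlin c X d Y) = vlin c (lie_bracket Z X) d (lie_bracket Z Y)"
proof (intro ext)
  fix p f
  have "lie_bracket Z (vlin c X d Y) p f = - lie_bracket (vlin c X d Y) Z p f"
    by (simp add: lie_bracket_def)
  also have "\<dots> = vlin c (lie_bracket Z X) d (lie_bracket Z Y) p f"
    unfolding lie_bracket_vlin_left[OF assms] by (simp add: vlin_apply lie_bracket_def algebra_simps)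
  finally show "lie_bracket Z (vlin c X d Y) p f = vlin c (lie_bracket Z X) d (lie_bracket Z Y) p f" .
qed

section \<open>The endomorphism field \<open>a J + b I\<close>\<close>

lemma app_J_ab: "app (J_ab J a b) X = vlin a (app J X) b X"
  by (simp add: app_def J_ab_def vlin_def fun_eq_iff)

lemma endo_field_app: "endo_field M F \<Longrightarrow> X \<in> vector_fields M \<Longrightarrow> app F X \<in> vector_fields M"
  by (simp add: endo_field_def)

lemma endo_field_lin:
  assumes "endo_field M F" "p \<in> points M" "v \<in> tangent_space M p" "w \<in> tangent_space M p"
  shows "F p (c \<cdot>\<^sub>R v + d \<cdot>\<^sub>R w) = c \<cdot>\<^sub>R F p v + d \<cdot>\<^sub>R F p w"
  using assms by (simp add: endo_field_def tangent_space_scl)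

lemma app_vlin:
  assumes "smooth_manifold M" "endo_field M F" "X \<in> vector_fields M" "Y \<in> vector_fields M"
  shows "app F (vlin c X d Y) = vlin c (app F X) d (app F Y)"
proof
  fix p
  show "app F (vlin c X d Y) p = vlin c (app F X) d (app F Y) p"
  proof (cases "p \<in> points M")
    case True
    then show ?thesis
      using assms by (simp add: app_def vlin_def endo_field_lin vector_fieldsD(1) fun_eq_iff)
  next
    case False
    \<comment> \<open>Off the points \<open>endo_field\<close> gives no linearity of
      \<open>F p\<close>; the value zero comes from \<open>app F W\<close> being a vector
      field.\<close>
    have "app F W p = 0" if "W \<in> vector_fields M" for W
      by (rule vector_fieldsD(2)[OF endo_field_app[OF assms(2) that] False])
    then show ?thesis
      using assms by (simp add: fun_eq_iff vlin_apply vector_fields_vlin)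
  qed
qed

lemma endo_field_J_ab:
  assumes M: "smooth_manifold M" and J: "endo_field M J"
  shows "endo_field M (J_ab J a b)"
proof -
  have "J p v \<in> tangent_space M p" if "p \<in> points M" "v \<in> tangent_space M p" for p v
    using J that by (simp add: endo_field_def)
  moreover have "J p (v + w) = J p v + J p w" "J p (c \<cdot>\<^sub>R v) = c \<cdot>\<^sub>R J p v"
    if "p \<in> points M" "v \<in> tangent_space M p" "w \<in> tangent_space M p" for p v w c
    using J that by (simp_all add: endo_field_def)
  moreover have "app (J_ab J a b) X \<in> vector_fields M" if "X \<in> vector_fields M" for X
    unfolding app_J_ab using that M J by (simp add: vector_fields_vlin endo_field_app)
  ultimately show ?thesis
    unfolding endo_field_def
    by (auto simp: J_ab_def tangent_space_lin) (auto simp: scl_def algebra_simps fun_eq_iff)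
qed

text \<open>Expand by bilinearity. The terms ab[JX,Y] and ab[X,JY] each occur once with either sign,
  J[X,Y] has coefficient -ab - ab + 2ab, and [X,Y] has b^2 - b^2 - b^2 + b^2. Only the terms
  quadratic in J survive, each with the factor a^2.\<close>

lemma nijenhuis_J_ab:
  assumes M: "smooth_manifold M" and J: "endo_field M J"
    and "X \<in> vector_fields M" "Y \<in> vector_fields M"
  shows "nijenhuis (J_ab J a b) X Y p f = a\<^sup>2 * nijenhuis J X Y p f"
  using assms(3,4)
  by (simp add: nijenhuis_def app_J_ab lie_bracket_vlin_left[OF M] lie_bracket_vlin_right[OF M]
      app_vlin[OF M J] lie_bracket_in_vector_fields[OF M] vector_fields_vlin[OF M]
      endo_field_app[OF J] vlin_apply algebra_simps power2_eq_square)

section \<open>Connections and covariant derivatives\<close>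

lemma connection_vlin:
  assumes M: "smooth_manifold M" and D: "affine_connection M D"
    and X: "X \<in> vector_fields M" and Y: "Y \<in> vector_fields M" and Z: "Z \<in> vector_fields M"
  shows "D X (vlin c Y d Z) = vlin c (D X Y) d (D X Z)"
proof -
  \<comment> \<open>The real multiple of \<open>W\<close> by \<open>e\<close> is encoded with a
    dummy second summand of weight 0. The cut-off of the constant is harmless because
    \<open>W\<close> vanishes off the points.\<close>
  have const: "const_fun M e \<cdot>\<^sub>F W = vlin e W 0 W" if "W \<in> vector_fields M" for e W
    using vector_fieldsD(2)[OF that]
    by (auto simp: fscl_def vlin_def scl_def const_fun_def fun_eq_iff)
  have DW: "D X W \<in> vector_fields M" if "W \<in> vector_fields M" for W
    using D X that by (simp add: affine_connection_def)
  have scl: "D X (vlin e W 0 W) = vlin e (D X W) 0 (D X W)" if W: "W \<in> vector_fields M" for e W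
  proof -
    have "D X (const_fun M e \<cdot>\<^sub>F W) = ddir X (const_fun M e) \<cdot>\<^sub>F W + const_fun M e \<cdot>\<^sub>F D X W"
      using D X W smooth_funs_const[OF M] unfolding affine_connection_def by blast
    also have "\<dots> = const_fun M e \<cdot>\<^sub>F D X W"
      by (auto simp: ddir_const_fun[OF M X] fscl_def scl_def fun_eq_iff)
    finally show ?thesis by (simp add: const W DW)
  qed
  have "vlin c Y d Z = vlin c Y 0 Y + vlin d Z 0 Z"
    by (simp add: fun_eq_iff vlin_apply)
  moreover have "D X (vlin c Y 0 Y + vlin d Z 0 Z) = D X (vlin c Y 0 Y) + D X (vlin d Z 0 Z)"
    using D X vector_fields_vlin[OF M Y Y, of c 0] vector_fields_vlin[OF M Z Z, of d 0]
    unfolding affine_connection_def by blast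
  ultimately show ?thesis
    by (simp add: scl Y Z) (simp add: fun_eq_iff vlin_apply)
qed

text \<open>The identity part contributes b D_X Y to both terms of the covariant derivative and
  cancels.\<close>

lemma cov_deriv_J_ab:
  assumes "smooth_manifold M" "endo_field M J" "affine_connection M D"
    and "X \<in> vector_fields M" "Y \<in> vector_fields M"
  shows "cov_deriv D X (J_ab J a b) Y p f = a * cov_deriv D X J Y p f"
  using assms
  by (simp add: cov_deriv_def app_J_ab connection_vlin endo_field_app vlin_apply algebra_simps)

section \<open>The metallic structure\<close>

lemma metallic_J_ab:
  assumes "norden_manifold M J g"
  shows "metallic_pseudo_riemannian M (J_ab J a b) g"
proof -
  have M: "smooth_manifold M" and J: "endo_field M J" and g: "pseudo_riemannian_metric M g"
    and sym: "g_symmetric M g J"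
    and JJ: "\<And>p v. p \<in> points M \<Longrightarrow> v \<in> tangent_space M p \<Longrightarrow> J p (J p v) = - v"
    using assms by (auto simp: norden_manifold_def almost_complex_def neutral_metric_def)
  have gcom: "g p u v = g p v u" and gscl: "g p (c \<cdot>\<^sub>R u) v = c * g p u v"
    if "p \<in> points M" "u \<in> tangent_space M p" "v \<in> tangent_space M p" for p u v c
    using g that by (simp_all add: pseudo_riemannian_metric_def)
  have gadd: "g p (u + v) w = g p u w + g p v w"
    if "p \<in> points M" "u \<in> tangent_space M p" "v \<in> tangent_space M p" "w \<in> tangent_space M p"
    for p u v w
    using g that by (simp_all add: pseudo_riemannian_metric_def)
  have glin: "g p (c \<cdot>\<^sub>R u + d \<cdot>\<^sub>R v) w = c * g p u w + d * g p v w"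
    if "p \<in> points M" "u \<in> tangent_space M p" "v \<in> tangent_space M p" "w \<in> tangent_space M p"
    for p u v w c d
    using that by (simp add: gadd gscl tangent_space_scl)
  have "g p (app (J_ab J a b) X p) (Y p) = g p (X p) (app (J_ab J a b) Y p)"
    if X: "X \<in> vector_fields M" and Y: "Y \<in> vector_fields M" and p: "p \<in> points M" for X Y p
  proof -
    note tan = vector_fieldsD(1)[OF X p] vector_fieldsD(1)[OF Y p]
      vector_fieldsD(1)[OF endo_field_app[OF J X] p] vector_fieldsD(1)[OF endo_field_app[OF J Y] p]
    have "g p (app (J_ab J a b) X p) (Y p) = a * g p (app J X p) (Y p) + b * g p (X p) (Y p)"
      by (simp add: app_J_ab vlin_def glin tan p)
    \<comment> \<open>Linearity of \<open>g\<close> is recorded in its first slot only, so both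
      products are flipped, the first after moving \<open>J\<close> across by its symmetry.\<close>
    also have "\<dots> = a * g p (app J Y p) (X p) + b * g p (Y p) (X p)"
      using sym X Y p gcom[OF p] tan unfolding g_symmetric_def by metis
    also have "\<dots> = g p (app (J_ab J a b) Y p) (X p)"
      by (simp add: app_J_ab vlin_def glin tan p)
    also have "\<dots> = g p (X p) (app (J_ab J a b) Y p)"
      by (rule gcom[OF p _ tan(1)]) (simp add: app_J_ab vlin_def tangent_space_lin tan)
    finally show ?thesis .
  qed
  then have "g_symmetric M g (J_ab J a b)" by (simp add: g_symmetric_def)
  \<comment> \<open>The coefficients are those of the real quadratic with roots b + ai and b - ai,
    which aJ + bI satisfies since J^2 = -I.\<close>
  moreover have "J_ab J a b p (J_ab J a b p v) = (2 * b) \<cdot>\<^sub>R J_ab J a b p v + (- (a\<^sup>2 + b\<^sup>2)) \<cdot>\<^sub>R v"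
    if p: "p \<in> points M" and v: "v \<in> tangent_space M p" for p v
  proof -
    have "J p v \<in> tangent_space M p"
      using J p v by (simp add: endo_field_def)
    then show ?thesis
      using p v
      by (simp add: J_ab_def endo_field_lin[OF J] JJ)
         (simp add: scl_def fun_eq_iff algebra_simps power2_eq_square)
  qed
  ultimately show ?thesis
    using M g endo_field_J_ab[OF M J] unfolding metallic_pseudo_riemannian_def by blast
qed

theorem proposition4p2:
  fixes M :: "('a, 'e::euclidean_space) manifold"
    and J :: "'a endo" and g :: "'a bilin" and D :: "'a conn"
    and a b :: real
  assumes "norden_manifold M J g"
    and "levi_civita M g D"
    and "a \<noteq> 0"
  shows "(integrable_endo M (J_ab J a b) \<longleftrightarrow> integrable_endo M J) \<and>
         (locally_metallic M (J_ab J a b) g D \<longleftrightarrow> kaehler_norden M J g D) \<and>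
         (nearly_locally_metallic M (J_ab J a b) g D \<longleftrightarrow> nearly_kaehler_norden M J g D)"
proof -
  have M: "smooth_manifold M" and J: "endo_field M J" and D: "affine_connection M D"
    using assms by (auto simp: norden_manifold_def almost_complex_def levi_civita_def)
  have "integrable_endo M (J_ab J a b) \<longleftrightarrow> integrable_endo M J"
    using \<open>a \<noteq> 0\<close> by (simp add: integrable_endo_def fun_eq_iff nijenhuis_J_ab[OF M J])
  moreover have "parallel_endo M D (J_ab J a b) \<longleftrightarrow> parallel_endo M D J"
    using \<open>a \<noteq> 0\<close> by (simp add: parallel_endo_def fun_eq_iff cov_deriv_J_ab[OF M J D])
  moreover have "nearly_parallel_endo M D (J_ab J a b) \<longleftrightarrow> nearly_parallel_endo M D J"
    \<comment> \<open>Reading \<open>distrib_left\<close> backwards pulls the common factor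
      \<open>a\<close> out of the symmetrized sum, so that it can be divided out.\<close>
    using \<open>a \<noteq> 0\<close>
    by (simp add: nearly_parallel_endo_def fun_eq_iff cov_deriv_J_ab[OF M J D]
        flip: distrib_left)
  \<comment> \<open>Both sides of the last two equivalences also contain the underlying structure:
    the Norden one is assumed, the metallic one is \<open>metallic_J_ab\<close>.\<close>
  ultimately show ?thesis
    using assms(1) metallic_J_ab[OF assms(1)]
    by (simp add: locally_metallic_def nearly_locally_metallic_def
        kaehler_norden_def nearly_kaehler_norden_def)
qed

end
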